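(* Let $s,\gamma_+,\gamma_->0$, let $m\ge1$ be an integer, let $\alpha\in\mathbb R^m$ satisfy $\alpha_i\ge0$ for all $i$ and $\sum_{i=1}^m\alpha_i<1$, and let $\eta_0\in\mathbb R$ and $\eta\in\mathbb R^m$. Then there exist functions $\psi_+,\psi_-\in C^2(\mathbb R)$ such that $\pm\psi_\pm'(\eta_0)>0$ and the set of solutions of the problem $$-u''=s^2(\gamma_+^2u^+-\gamma_-^2u^-)\ \text{ on }\mathbb R,\qquad u(\eta_0)=\sum_{i=1}^m\alpha_iu(\eta_i),$$ has the form $$\{C_+\psi_+:C_+\ge0\}\cup\{C_-\psi_-:C_-\ge0\}.$$
   Context: $u^\pm(x)=\max\{\pm u(x),0\}$. Solutions are functions $u\in C^2(\mathbb R)$. *)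

theory Defs
  imports "HOL-Analysis.Analysis"
begin

definition C2_real :: "(real \<Rightarrow> real) \<Rightarrow> bool" where
  "C2_real u \<longleftrightarrow>
     u differentiable_on UNIV \<and> deriv u differentiable_on UNIV \<and>
     continuous_on UNIV (deriv (deriv u))"

definition pos_part :: "(real \<Rightarrow> real) \<Rightarrow> real \<Rightarrow> real" where
  "pos_part u x = max (u x) 0"

text \<open>The negative part is nonnegative, so that \<open>u x = pos_part u x - neg_part u x\<close>.\<close>

definition neg_part :: "(real \<Rightarrow> real) \<Rightarrow> real \<Rightarrow> real" where
  "neg_part u x = max (- u x) 0"

definition multipoint_solution ::
  "real \<Rightarrow> real \<Rightarrow> real \<Rightarrow> real ^ 'm \<Rightarrow> real \<Rightarrow> real ^ 'm \<Rightarrow> (real \<Rightarrow> real) \<Rightarrow> bool" where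
  "multipoint_solution s \<gamma>p \<gamma>m \<alpha> \<eta>0 \<eta> u \<longleftrightarrow>
     C2_real u \<and>
     (\<forall>x. - deriv (deriv u) x = s\<^sup>2 * (\<gamma>p\<^sup>2 * pos_part u x - \<gamma>m\<^sup>2 * neg_part u x)) \<and>
     u \<eta>0 = (\<Sum>i\<in>UNIV. \<alpha> $ i * u (\<eta> $ i))"

end

theory Submission
  imports Defs
begin

text \<open>
  With \<open>a = s \<gamma>\<^sub>+\<close> and \<open>b = s \<gamma>\<^sub>-\<close>, every solution of the differential equation is a nonnegative
  multiple of a translate of one periodic solution \<open>w\<close>, whose phase curve \<open>(w, w')\<close> is the boundary
  of the convex body \<open>K\<close> formed by two half ellipses. The translates with nonnegative slope at
  \<open>\<eta>0\<close> are parametrised by the phase \<open>t\<close> in \<open>[-\<pi>/(2b), \<pi>/(2a)]\<close>, and the boundary condition reads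
  \<open>F t = 0\<close> with \<open>F t = w t - (\<Sum>i. \<alpha> i * w (t + d i))\<close> for the offsets \<open>d i = \<eta> i - \<eta>0\<close>. Since
  the sum of the \<open>\<alpha> i\<close> is less than 1, \<open>F\<close> is negative at the left and positive at the right
  end. At a zero of \<open>F\<close> the point \<open>\<Sum>i. \<alpha> i * (w, w') (t + d i)\<close> lies in the interior of \<open>K\<close>
  on the same vertical line as \<open>(w t, w' t)\<close>, so that \<open>F' t > 0\<close>. Hence the zero is unique. The
  solutions with nonpositive slope are obtained by reflection at \<open>\<eta>0\<close>.
\<close>

section \<open>One-sided derivatives and zeros of real functions\<close>

lemma has_real_derivative_from_sides:
  fixes f :: "real \<Rightarrow> real"
  assumes "(f has_real_derivative D) (at x within {..x})"
    and "(f has_real_derivative D) (at x within {x..})"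
  shows "(f has_real_derivative D) (at x)"
proof -
  have "(f has_real_derivative D) (at x within {..x} \<union> {x..})"
    using assms unfolding has_field_derivative_iff by (rule Lim_Un)
  moreover have "{..x} \<union> {x..} = UNIV" by auto
  ultimately show ?thesis by simp
qed

text \<open>If \<open>y < z\<close> were two zeros, \<open>f\<close> would be positive just after
  \<open>y\<close>. The first zero beyond such a point would then be reached from positive values,
  although a positive derivative there makes \<open>f\<close> negative just before it.\<close>

lemma unique_zero_if_increasing_at_zeros:
  fixes f f' :: "real \<Rightarrow> real"
  assumes der: "\<And>x. x \<in> {p..q} \<Longrightarrow> (f has_real_derivative f' x) (at x)"
    and pos: "\<And>x. x \<in> {p..q} \<Longrightarrow> f x = 0 \<Longrightarrow> f' x > 0"
    and y: "y \<in> {p..q}" "f y = 0" and z: "z \<in> {p..q}" "f z = 0"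
  shows "y = z"
proof -
  have False if y: "y \<in> {p..q}" "f y = 0" and z: "z \<in> {p..q}" "f z = 0" and "y < z" for y z
  proof -
    obtain e where e: "e > 0" "\<And>h. 0 < h \<Longrightarrow> h < e \<Longrightarrow> f y < f (y + h)"
      using DERIV_pos_inc_right[OF der[OF y(1)] pos[OF y]] by blast
    \<comment> \<open>The minimum keeps \<open>c\<close> within the range where \<open>f\<close>
      exceeds \<open>f y = 0\<close> and also strictly below \<open>z\<close>.\<close>
    define c where "c = y + min (e/2) ((z - y)/2)"
    have c: "y < c" "c < z" using e(1) \<open>y < z\<close> unfolding c_def by (auto simp: min_def field_simps)
    have fc: "f c > 0"
      using e(2)[of "min (e/2) ((z - y)/2)"] e(1) \<open>y < z\<close> y(2) unfolding c_def by (auto simp: min_def)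
    have cont: "continuous_on {c..z} f"
      by (rule DERIV_continuous_on[of _ _ f'], rule has_field_derivative_at_within, rule der)
        (use c y z in auto)
    define Z where "Z = {x \<in> {c..z}. f x = 0}"
    have "closed Z" unfolding Z_def
      using continuous_closed_preimage_constant[OF cont] by simp
    moreover have "Z \<noteq> {}" "bdd_below Z"
      using z c by (auto simp: Z_def intro!: bdd_belowI[of _ c])
    ultimately have inf: "Inf Z \<in> Z" by (meson closed_contains_Inf)
    define x where "x = Inf Z"
    have x: "c \<le> x" "x \<le> z" "f x = 0" using inf by (auto simp: x_def Z_def)
    have "c < x" using x fc by (cases "c = x") auto
    have xpq: "x \<in> {p..q}" using x c y z by auto
    obtain d where d: "d > 0" "\<And>h. 0 < h \<Longrightarrow> h < d \<Longrightarrow> f (x - h) < f x"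
      using DERIV_pos_inc_left[OF der[OF xpq] pos[OF xpq x(3)]] by blast
    \<comment> \<open>\<open>f\<close> changes sign between \<open>c\<close> and \<open>v\<close>,
      which produces a zero before the first zero \<open>x\<close>.\<close>
    define v where "v = x - min (d/2) ((x - c)/2)"
    have v: "c < v" "v < x" using d(1) \<open>c < x\<close> unfolding v_def by (auto simp: min_def field_simps)
    have fv: "f v < 0"
      using d(2)[of "min (d/2) ((x - c)/2)"] d(1) \<open>c < x\<close> x(3) unfolding v_def by (auto simp: min_def)
    have "continuous_on {c..v} f" using cont v x by (auto elim: continuous_on_subset)
    then obtain r where "c \<le> r" "r \<le> v" "f r = 0"
      using IVT2'[of f v 0 c] fc fv v by auto
    then have "r \<in> Z" using v x by (auto simp: Z_def)
    then have "x \<le> r" unfolding x_def using \<open>bdd_below Z\<close> by (rule cInf_lower)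
    with \<open>r \<le> v\<close> v show False by simp
  qed
  from this[OF y z] this[OF z y] show ?thesis by fastforce
qed

section \<open>Periodic extension from one cell\<close>

definition periodize :: "real \<Rightarrow> real \<Rightarrow> (real \<Rightarrow> real) \<Rightarrow> real \<Rightarrow> real" where
  "periodize p q f x = f (x - of_int \<lfloor>(x - p) / (q - p)\<rfloor> * (q - p))"

lemma reduced_argument_bounds:
  assumes "p < (q::real)"
  shows "x - of_int \<lfloor>(x - p) / (q - p)\<rfloor> * (q - p) \<in> {p..<q}"
  using floor_divide_lower[of "q - p" "x - p"] floor_divide_upper[of "q - p" "x - p"] assms
  by (simp add: algebra_simps)

text \<open>The matching end values extend the formula from the half-open cell to the closed one: if
  the reduced argument is \<open>q\<close>, the floor is already \<open>k + 1\<close> and the value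
  is \<open>f p = f q\<close>. The right end is what left derivatives at cell boundaries
  need.\<close>

lemma periodize_cell:
  assumes "p < q" "f p = f q" "x - of_int k * (q - p) \<in> {p..q}"
  shows "periodize p q f x = f (x - of_int k * (q - p))"
proof (cases "x - of_int k * (q - p) = q")
  case True
  then have "(x - p) / (q - p) = of_int (k + 1)" using assms(1) by (simp add: field_simps)
  then have "\<lfloor>(x - p) / (q - p)\<rfloor> = k + 1" by (metis floor_of_int)
  then have "periodize p q f x = f (x - of_int k * (q - p) - (q - p))"
    by (simp add: periodize_def algebra_simps)
  then show ?thesis using True assms(2) by simp
next
  case False
  then have "\<lfloor>(x - p) / (q - p)\<rfloor> = k" using assms(1,3)
    by (auto intro!: floor_unique simp: field_simps)
  then show ?thesis by (simp add: periodize_def)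
qed

lemma periodize_base:
  assumes "p < q" "f p = f q" "x \<in> {p..q}"
  shows "periodize p q f x = f x"
  using periodize_cell[of p q f x 0] assms by simp

text \<open>Near a point inside a cell the extension is a single translate of \<open>f\<close>. At a
  cell boundary the right derivative comes from the cell that begins there and the left one from the
  cell that ends there; they agree because \<open>g p = g q\<close>.\<close>

lemma has_real_derivative_periodize:
  assumes "p < q" and eq: "f p = f q" "g p = g q"
    and der: "\<And>x. (f has_real_derivative g x) (at x)"
  shows "(periodize p q f has_real_derivative periodize p q g x) (at x)"
proof -
  define L where "L = q - p"
  define k where "k = \<lfloor>(x - p) / (q - p)\<rfloor>"
  have L: "L > 0" using assms(1) by (simp add: L_def)
  have r: "p \<le> x - of_int k * L" "x - of_int k * L < q"
    using reduced_argument_bounds[OF assms(1), of x] by (auto simp: L_def k_def)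
  have cell: "periodize p q f y = f (y - of_int j * L)"
    if "y - of_int j * L \<in> {p..q}" for y j
    using periodize_cell[OF assms(1) eq(1)] that by (simp add: L_def)
  have cellg: "periodize p q g x = g (x - of_int j * L)" if "x - of_int j * L \<in> {p..q}" for j
    using periodize_cell[OF assms(1) eq(2)] that by (simp add: L_def)
  have shift: "((\<lambda>y. f (y - of_int j * L)) has_real_derivative g (x - of_int j * L)) (at x within S)"
    for j S
    by (rule DERIV_chain2[OF der, where s = S, THEN DERIV_cong])
      (auto intro!: derivative_eq_intros)
  show ?thesis
  proof (rule has_real_derivative_from_sides)
    show "(periodize p q f has_real_derivative periodize p q g x) (at x within {x..})"
    proof (rule has_field_derivative_transform_within)
      show "((\<lambda>y. f (y - of_int k * L)) has_real_derivative periodize p q g x) (at x within {x..})"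
        using shift[of k] cellg[of k] r by simp
      show "0 < q - (x - of_int k * L)" using r by simp
    next
      fix y assume "y \<in> {x..}" "dist y x < q - (x - of_int k * L)"
      then show "f (y - of_int k * L) = periodize p q f y"
        using r by (intro cell[symmetric]) (auto simp: dist_real_def)
    qed simp
    show "(periodize p q f has_real_derivative periodize p q g x) (at x within {..x})"
    proof (cases "x - of_int k * L = p")
      case False
      show ?thesis
      proof (rule has_field_derivative_transform_within)
        show "((\<lambda>y. f (y - of_int k * L)) has_real_derivative periodize p q g x) (at x within {..x})"
          using shift[of k] cellg[of k] r by simp
        show "0 < x - of_int k * L - p" using r False by simp
      next
        fix y assume "y \<in> {..x}" "dist y x < x - of_int k * L - p"
        then show "f (y - of_int k * L) = periodize p q f y"
          using r by (intro cell[symmetric]) (auto simp: dist_real_def)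
      qed simp
    next
      case True
      \<comment> \<open>Seen from the preceding cell, numbered \<open>k - 1\<close>, the point
        \<open>x\<close> is the right end.\<close>
      then have xq: "x - of_int (k - 1) * L = q" by (simp add: L_def algebra_simps)
      show ?thesis
      proof (rule has_field_derivative_transform_within)
        show "((\<lambda>y. f (y - of_int (k - 1) * L)) has_real_derivative periodize p q g x)
          (at x within {..x})"
          using shift[of "k - 1"] cellg[of "k - 1"] xq assms(1) by simp
        show "0 < L" by (rule L)
      next
        fix y assume "y \<in> {..x}" "dist y x < L"
        then show "f (y - of_int (k - 1) * L) = periodize p q f y"
          using xq by (intro cell[symmetric]) (auto simp: dist_real_def L_def)
      qed simp
    qed
  qed
qed

section \<open>The piecewise linear force, its energy and motions in phase space\<close>

locale asymmetric_oscillator =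
  fixes a b :: real
  assumes a: "a > 0" and b: "b > 0"
begin

definition force :: "real \<Rightarrow> real" where
  "force v = a\<^sup>2 * max v 0 - b\<^sup>2 * max (- v) 0"

text \<open>An asymmetric norm on the line: \<open>(stretch u)\<^sup>2 + u'\<^sup>2\<close> is twice
  the conserved energy, and the convex body \<open>K\<close> is where this is at most 1. Writing it
  as a maximum of two linear functions makes it visibly sublinear.\<close>

definition stretch :: "real \<Rightarrow> real" where
  "stretch v = max (a * v) (- (b * v))"

text \<open>The first-order system, with the velocity as a second function, so that the phase point
  \<open>(u, u')\<close> is at hand and symmetries act on both components.\<close>

definition motion :: "(real \<Rightarrow> real) \<Rightarrow> (real \<Rightarrow> real) \<Rightarrow> bool" where
  "motion u u' \<longleftrightarrow> (\<forall>x. (u has_real_derivative u' x) (at x) \<and>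
                        (u' has_real_derivative - force (u x)) (at x))"

lemma stretch_nonneg: "stretch v \<ge> 0"
  using a b by (cases "v \<ge> 0") (auto simp: stretch_def le_max_iff_disj mult_nonneg_nonpos)

lemma stretch_eq_0_iff: "stretch v = 0 \<longleftrightarrow> v = 0"
  using a b by (auto simp: stretch_def max_def split: if_splits)

lemma stretch_nonneg_arg: "v \<ge> 0 \<Longrightarrow> stretch v = a * v"
  using a b by (simp add: stretch_def) (smt (verit) mult_nonneg_nonneg)

lemma stretch_nonpos_arg: "v \<le> 0 \<Longrightarrow> stretch v = - (b * v)"
  using a b by (simp add: stretch_def) (smt (verit) mult_nonneg_nonpos)

text \<open>Each of the two linear functions in the maximum is bounded by \<open>stretch\<close>
  termwise, and nonnegative weights preserve these bounds.\<close>

lemma stretch_sum_le: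
  assumes "\<And>i. i \<in> I \<Longrightarrow> \<alpha> i \<ge> 0"
  shows "stretch (\<Sum>i\<in>I. \<alpha> i * v i) \<le> (\<Sum>i\<in>I. \<alpha> i * stretch (v i))"
proof -
  have "a * (\<Sum>i\<in>I. \<alpha> i * v i) \<le> (\<Sum>i\<in>I. \<alpha> i * stretch (v i))"
    unfolding sum_distrib_left mult.left_commute[of a]
    by (intro sum_mono mult_left_mono) (auto simp: stretch_def assms)
  moreover have "- (b * (\<Sum>i\<in>I. \<alpha> i * v i)) = (\<Sum>i\<in>I. \<alpha> i * (- (b * v i)))"
    by (simp add: sum_distrib_left sum_negf algebra_simps)
  moreover have "\<dots> \<le> (\<Sum>i\<in>I. \<alpha> i * stretch (v i))"
    by (intro sum_mono mult_left_mono) (auto simp: stretch_def assms)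
  ultimately show ?thesis by (simp add: stretch_def)
qed

section \<open>Lipschitz bound, symmetries and uniqueness of motions\<close>

lemma force_lipschitz: "\<bar>force v - force w\<bar> \<le> (a\<^sup>2 + b\<^sup>2) * \<bar>v - w\<bar>"
proof -
  have "\<bar>a\<^sup>2 * (max v 0 - max w 0)\<bar> \<le> a\<^sup>2 * \<bar>v - w\<bar>"
    unfolding abs_mult by (simp add: mult_left_mono)
  moreover have "\<bar>b\<^sup>2 * (max (- v) 0 - max (- w) 0)\<bar> \<le> b\<^sup>2 * \<bar>v - w\<bar>"
    unfolding abs_mult by (simp add: mult_left_mono)
  moreover have "force v - force w = a\<^sup>2 * (max v 0 - max w 0) - b\<^sup>2 * (max (- v) 0 - max (- w) 0)"
    by (simp add: force_def algebra_simps)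
  ultimately show ?thesis
    using abs_triangle_ineq4[of "a\<^sup>2 * (max v 0 - max w 0)" "b\<^sup>2 * (max (- v) 0 - max (- w) 0)"]
    by (simp add: distrib_right)
qed

text \<open>Homogeneity holds for nonnegative factors only, as a negative one would exchange the two
  slopes. This is why the solutions form rays instead of lines.\<close>

lemma force_scale: "C \<ge> 0 \<Longrightarrow> force (C * v) = C * force v"
  by (cases "v \<ge> 0"; cases "C = 0")
    (auto simp: force_def max_def algebra_simps zero_le_mult_iff mult_le_0_iff)

lemma motion_scale:
  assumes "motion u u'" "C \<ge> 0"
  shows "motion (\<lambda>x. C * u x) (\<lambda>x. C * u' x)"
  using assms(1) DERIV_cmult[where c = C] unfolding motion_def force_scale[OF assms(2)]
  by (metis mult_minus_right)

lemma motion_shift: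
  assumes "motion u u'"
  shows "motion (\<lambda>x. u (x + d)) (\<lambda>x. u' (x + d))"
  using assms unfolding motion_def by (blast intro: DERIV_shift[THEN iffD1])

text \<open>The equation has no first-order term, so time reversal preserves it while the velocity
  changes sign.\<close>

lemma motion_reflect:
  assumes "motion u u'"
  shows "motion (\<lambda>x. u (c - x)) (\<lambda>x. - u' (c - x))"
proof -
  have "((\<lambda>x. u (c - x)) has_real_derivative u' (c - x) * (-1)) (at x)"
    "((\<lambda>x. u' (c - x)) has_real_derivative - force (u (c - x)) * (-1)) (at x)" for x
    using assms unfolding motion_def
    by (intro DERIV_chain2[where g = "\<lambda>x. c - x"]; auto intro!: derivative_eq_intros)+
  then show ?thesis
    unfolding motion_def using DERIV_minus by fastforce
qed

text \<open>Gronwall's argument for \<open>E = (u - v)\<^sup>2 + (u' - v')\<^sup>2\<close>, for which \<open>\<bar>E'\<bar> \<le> M * E\<close>.\<close>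

lemma motion_unique:
  assumes u: "motion u u'" and v: "motion v v'" and init: "u c = v c" "u' c = v' c"
  shows "u = v"
proof (rule ext)
  fix x
  \<comment> \<open>The summand 1 accounts for the derivative of \<open>(u - v)\<^sup>2\<close>, the
    rest is the Lipschitz constant of \<open>force\<close>.\<close>
  define M where "M = 1 + (a\<^sup>2 + b\<^sup>2)"
  define E where "E = (\<lambda>y. (u y - v y)\<^sup>2 + (u' y - v' y)\<^sup>2)"
  define E' where "E' = (\<lambda>y. 2 * (u y - v y) * (u' y - v' y)
    + 2 * (u' y - v' y) * (force (v y) - force (u y)))"
  have der: "(E has_real_derivative E' y) (at y)" for y
    using u v unfolding E_def E'_def motion_def
    by (auto intro!: derivative_eq_intros simp: algebra_simps)
  have bound: "\<bar>E' y\<bar> \<le> M * E y" for y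
  proof -
    define d where "d = \<bar>u y - v y\<bar>"
    define e where "e = \<bar>u' y - v' y\<bar>"
    have "\<bar>E' y\<bar> \<le> 2 * d * e + 2 * e * \<bar>force (v y) - force (u y)\<bar>"
      unfolding E'_def d_def e_def by (rule order.trans[OF abs_triangle_ineq]) (simp only: abs_mult abs_numeral order_refl)
    also have "\<dots> \<le> 2 * d * e + 2 * e * ((a\<^sup>2 + b\<^sup>2) * d)"
      using force_lipschitz[of "v y" "u y"]
      by (intro add_left_mono mult_left_mono) (auto simp: d_def e_def abs_minus_commute)
    also have "\<dots> = M * (2 * d * e)" by (simp add: M_def algebra_simps)
    also have "\<dots> \<le> M * (d\<^sup>2 + e\<^sup>2)"
      using sum_squares_bound[of d e] by (intro mult_left_mono) (auto simp: M_def)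
    finally show ?thesis by (simp add: d_def e_def E_def)
  qed
  have Ec: "E c = 0" by (simp add: E_def init)
  \<comment> \<open>The integrating factor \<open>exp (- (M * y))\<close> makes the product
    nonincreasing to the right of \<open>c\<close>, and \<open>exp (M * y)\<close> makes it
    nondecreasing to the left; both products vanish at \<open>c\<close>.\<close>
  have "E x \<le> 0"
  proof (cases "c \<le> x")
    case True
    have "E x * exp (- (M * x)) \<le> E c * exp (- (M * c))"
    proof (rule DERIV_nonpos_imp_nonincreasing[OF True, of "\<lambda>y. E y * exp (- (M * y))"])
      fix y
      have "((\<lambda>y. E y * exp (- (M * y))) has_real_derivative (E' y - M * E y) * exp (- (M * y))) (at y)"
        by (auto intro!: derivative_eq_intros der simp: algebra_simps)
      moreover have "(E' y - M * E y) * exp (- (M * y)) \<le> 0"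
        using bound[of y] by (intro mult_nonpos_nonneg) auto
      ultimately show "\<exists>D. ((\<lambda>y. E y * exp (- (M * y))) has_real_derivative D) (at y) \<and> D \<le> 0"
        by blast
    qed
    then show ?thesis by (simp add: Ec mult_le_0_iff)
  next
    case False
    have "E x * exp (M * x) \<le> E c * exp (M * c)"
    proof (rule DERIV_nonneg_imp_nondecreasing[of x c "\<lambda>y. E y * exp (M * y)"])
      show "x \<le> c" using False by simp
      fix y
      have "((\<lambda>y. E y * exp (M * y)) has_real_derivative (E' y + M * E y) * exp (M * y)) (at y)"
        by (auto intro!: derivative_eq_intros der simp: algebra_simps)
      moreover have "(E' y + M * E y) * exp (M * y) \<ge> 0"
        using bound[of y] by (intro mult_nonneg_nonneg) auto
      ultimately show "\<exists>D. ((\<lambda>y. E y * exp (M * y)) has_real_derivative D) (at y) \<and> D \<ge> 0"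
        by blast
    qed
    then show ?thesis by (simp add: Ec mult_le_0_iff)
  qed
  then have "(u x - v x)\<^sup>2 \<le> 0" unfolding E_def by (smt (verit) zero_le_power2)
  then show "u x = v x" by simp
qed

section \<open>The periodic solution\<close>

definition arch :: "real \<Rightarrow> real" where
  "arch r = (if r \<le> 0 then sin (b * r) / b else sin (a * r) / a)"

definition arch' :: "real \<Rightarrow> real" where
  "arch' r = (if r \<le> 0 then cos (b * r) else cos (a * r))"

definition arch'' :: "real \<Rightarrow> real" where
  "arch'' r = (if r \<le> 0 then - b * sin (b * r) else - a * sin (a * r))"

text \<open>The cell holds one negative half wave of length \<open>pi / b\<close> and one positive
  half wave of length \<open>pi / a\<close>. Only there do the two sine pieces of
  \<open>arch\<close> have the signs that match the branches of \<open>force\<close>.\<close>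

definition wave :: "real \<Rightarrow> real" where
  "wave = periodize (- pi / b) (pi / a) arch"

definition wave' :: "real \<Rightarrow> real" where
  "wave' = periodize (- pi / b) (pi / a) arch'"

lemma DERIV_arch: "(arch has_real_derivative arch' r) (at r)"
  and DERIV_arch': "(arch' has_real_derivative arch'' r) (at r)"
proof -
  \<comment> \<open>Gluing at 0 of two differentiable functions with equal values and equal
    derivatives there.\<close>
  have *: "((\<lambda>r. if r \<le> 0 then f r else g r) has_real_derivative (if r \<le> 0 then f' r else g' r)) (at r)"
    if "\<And>r. (f has_real_derivative f' r) (at r)" "\<And>r. (g has_real_derivative g' r) (at r)"
      "f 0 = g 0" "f' 0 = g' 0" for f g f' g' :: "real \<Rightarrow> real"
  proof (rule has_real_derivative_from_sides)
    let ?h = "\<lambda>r. if r \<le> 0 then f r else g r" and ?D = "if r \<le> 0 then f' r else g' r"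
    have f: "(f has_real_derivative f' r) (at r within S)"
      and g: "(g has_real_derivative g' r) (at r within S)" for S
      using that(1,2) by (blast intro: has_field_derivative_at_within)+
    have f0: "(?h has_real_derivative f' r) (at r within S)" if "r \<le> 0" "S \<subseteq> {..r} \<or> r < 0" "r \<in> S" for S
    proof (rule has_field_derivative_transform_within[OF f])
      \<comment> \<open>For \<open>r < 0\<close> this radius keeps the points negative; for
        \<open>r = 0\<close> the set \<open>S\<close> lies to the left of 0 and any radius will
        do.\<close>
      show "0 < (if r < 0 then - r else 1)" by simp
    qed (use that in \<open>auto simp: dist_real_def split: if_splits\<close>)
    have g0: "(?h has_real_derivative g' r) (at r within S)" if "r \<ge> 0" "S \<subseteq> {r..} \<or> r > 0" "r \<in> S" for S
    proof (rule has_field_derivative_transform_within[OF g])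
      show "0 < (if r > 0 then r else 1)" by simp
      fix y assume "y \<in> S" "dist y r < (if r > 0 then r else 1)"
      then show "g y = ?h y"
        using that \<open>f 0 = g 0\<close> by (cases "y = 0") (auto simp: dist_real_def split: if_splits)
    qed (rule that)
    show "(?h has_real_derivative ?D) (at r within {..r})"
      using f0[of "{..r}"] g0[of "{..r}"] by auto
    show "(?h has_real_derivative ?D) (at r within {r..})"
      using f0[of "{r..}"] g0[of "{r..}"] \<open>f' 0 = g' 0\<close> by (cases "r = 0") auto
  qed
  show "(arch has_real_derivative arch' r) (at r)"
    unfolding arch_def arch'_def using a b
    by (intro *) (auto intro!: derivative_eq_intros)
  show "(arch' has_real_derivative arch'' r) (at r)"
    unfolding arch'_def arch''_def using a b
    by (intro *) (auto intro!: derivative_eq_intros)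
qed

lemma cell_nonempty: "- pi / b < pi / a"
proof -
  have "- pi / b < 0" "0 < pi / a" using a b by auto
  then show ?thesis by linarith
qed

lemma arch_ends: "arch (- pi / b) = arch (pi / a)"
  and arch'_ends: "arch' (- pi / b) = arch' (pi / a)"
  and arch''_ends: "arch'' (- pi / b) = arch'' (pi / a)"
proof -
  have "- pi / b < 0" "0 < pi / a" using a b by auto
  then have "- pi / b \<le> 0" "\<not> pi / a \<le> 0" by simp_all
  moreover have "b * (- pi / b) = - pi" "a * (pi / a) = pi" using a b by simp_all
  ultimately show "arch (- pi / b) = arch (pi / a)" "arch' (- pi / b) = arch' (pi / a)"
    "arch'' (- pi / b) = arch'' (pi / a)"
    unfolding arch_def arch'_def arch''_def by (simp_all only: if_True if_False) simp_all
qed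

text \<open>On the cell \<open>b * r\<close> and \<open>a * r\<close> stay within one half turn of
  0, so \<open>arch r\<close> has the sign of the branch in use. The energy identity is then that of
  sine and cosine.\<close>

lemma arch_cell:
  assumes "r \<in> {- pi / b..pi / a}"
  shows "arch'' r = - force (arch r)" and "(stretch (arch r))\<^sup>2 + (arch' r)\<^sup>2 = 1"
proof -
  have "arch'' r = - force (arch r) \<and> (stretch (arch r))\<^sup>2 + (arch' r)\<^sup>2 = 1"
  proof (cases "r \<le> 0")
    case True
    have "- pi \<le> b * r" "b * r \<le> 0"
      using assms b True by (auto simp: field_simps mult_le_0_iff)
    then have "sin (b * r) \<le> 0" using sin_ge_zero[of "- (b * r)"] by simp
    then have "sin (b * r) / b \<le> 0" using b by (simp add: divide_le_0_iff)
    then show ?thesis using True b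
      by (simp add: arch_def arch'_def arch''_def force_def stretch_nonpos_arg power2_eq_square)
        (simp flip: power2_eq_square)
  next
    case False
    have "a * r \<le> pi" "0 \<le> a * r"
      using assms a False by (auto simp: field_simps)
    then have "sin (a * r) \<ge> 0" using sin_ge_zero[of "a * r"] by simp
    then have "sin (a * r) / a \<ge> 0" using a by simp
    then show ?thesis using False a
      by (simp add: arch_def arch'_def arch''_def force_def stretch_nonneg_arg power2_eq_square)
        (simp flip: power2_eq_square)
  qed
  then show "arch'' r = - force (arch r)" "(stretch (arch r))\<^sup>2 + (arch' r)\<^sup>2 = 1" by auto
qed

lemma wave_base: "t \<in> {- pi / b..pi / a} \<Longrightarrow> wave t = arch t"
  and wave'_base: "t \<in> {- pi / b..pi / a} \<Longrightarrow> wave' t = arch' t"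
  unfolding wave_def wave'_def
  by (intro periodize_base[OF cell_nonempty] arch_ends arch'_ends; assumption)+

lemma motion_wave: "motion wave wave'"
proof -
  have "periodize (- pi / b) (pi / a) arch'' x = - force (wave x)" for x
    using arch_cell(1) reduced_argument_bounds[OF cell_nonempty, of x]
    unfolding wave_def periodize_def by simp
  then show ?thesis
    unfolding motion_def wave_def wave'_def
    using has_real_derivative_periodize[OF cell_nonempty arch_ends arch'_ends DERIV_arch]
      has_real_derivative_periodize[OF cell_nonempty arch'_ends arch''_ends DERIV_arch']
    by (metis wave_def)
qed

lemma wave_energy: "(stretch (wave x))\<^sup>2 + (wave' x)\<^sup>2 = 1"
  using arch_cell(2) reduced_argument_bounds[OF cell_nonempty, of x]
  unfolding wave_def wave'_def periodize_def by simp

lemma wave_le: "a * wave x \<le> 1" and wave_ge: "- (b * wave x) \<le> 1"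
proof -
  have "(stretch (wave x))\<^sup>2 \<le> 1\<^sup>2" using wave_energy[of x] by (smt (verit) one_power2 zero_le_power2)
  then have "stretch (wave x) \<le> 1" by (rule power2_le_imp_le) simp
  then show "a * wave x \<le> 1" "- (b * wave x) \<le> 1" by (auto simp: stretch_def)
qed

section \<open>The rising half of the period\<close>

abbreviation rising_phases :: "real set" where
  "rising_phases \<equiv> {- pi / (2 * b)..pi / (2 * a)}"

lemma rising_phases_subset: "rising_phases \<subseteq> {- pi / b..pi / a}"
  using a b by (auto simp: field_simps)

lemma wave'_nonneg:
  assumes "t \<in> rising_phases"
  shows "wave' t \<ge> 0"
proof -
  have "wave' t = arch' t" using assms rising_phases_subset wave'_base by blast
  moreover have "arch' t \<ge> 0"
  proof (cases "t \<le> 0")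
    case True
    then have "- (pi/2) \<le> b * t" "b * t \<le> 0"
      using assms b by (auto simp: field_simps mult_le_0_iff)
    then show ?thesis using True by (simp add: arch'_def cos_ge_zero)
  next
    case False
    then have "a * t \<le> pi/2" "0 \<le> a * t" using assms a by (auto simp: field_simps)
    then show ?thesis using False by (simp add: arch'_def cos_ge_zero)
  qed
  ultimately show ?thesis by simp
qed

text \<open>These are the extreme values allowed by \<open>wave_ge\<close> and
  \<open>wave_le\<close>; they fix the signs of the boundary defect at both ends.\<close>

lemma wave_rising_ends: "wave (- pi / (2 * b)) = - 1 / b" "wave (pi / (2 * a)) = 1 / a"
proof -
  have "- pi / (2 * b) \<in> rising_phases" "pi / (2 * a) \<in> rising_phases"
    and s: "- pi / (2 * b) < 0" "0 < pi / (2 * a)"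
    using cell_nonempty a b by (auto simp: field_simps)
  then have "wave (- pi / (2 * b)) = arch (- pi / (2 * b))" "wave (pi / (2 * a)) = arch (pi / (2 * a))"
    using rising_phases_subset wave_base by blast+
  then show "wave (- pi / (2 * b)) = - 1 / b" "wave (pi / (2 * a)) = 1 / a"
    using s a b by (auto simp: arch_def)
qed

text \<open>After stretching, the phase curve becomes part of the unit circle, with
  \<open>stretch v = sin \<theta>\<close> and \<open>y = cos \<theta>\<close>. Since
  \<open>stretch\<close> forgets the sign of \<open>v\<close>, this sign decides between the phases
  \<open>\<theta> / a\<close> and \<open>- \<theta> / b\<close>.\<close>

lemma rising_phase_exists:
  assumes "(stretch v)\<^sup>2 + y\<^sup>2 = 1" "y \<ge> 0"
  obtains t where "t \<in> rising_phases" "wave t = v" "wave' t = y"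
proof -
  define \<theta> where "\<theta> = arccos y"
  have "y\<^sup>2 \<le> 1\<^sup>2" using assms(1) by (smt (verit) one_power2 zero_le_power2)
  then have y1: "y \<le> 1" by (rule power2_le_imp_le) simp
  have \<theta>: "0 \<le> \<theta>" "\<theta> \<le> pi / 2" "cos \<theta> = y"
    using assms(2) y1 arccos_le_pi2[of y]
    by (auto simp: \<theta>_def arccos_lbound)
  have "sin \<theta> = sqrt (1 - y\<^sup>2)" using assms(2) y1 by (simp add: \<theta>_def sin_arccos)
  also have "1 - y\<^sup>2 = (stretch v)\<^sup>2" using assms(1) by simp
  finally have sin: "sin \<theta> = stretch v" using stretch_nonneg by simp
  show ?thesis
  proof (cases "v > 0")
    case True
    have "sin \<theta> > 0" using sin stretch_nonneg_arg[of v] True a by simp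
    then have pos: "\<theta> > 0" using \<theta>(1) by (cases "\<theta> = 0") auto
    define t where "t = \<theta> / a"
    have t: "t \<in> rising_phases" "t > 0" using \<theta> a b pos
      by (auto simp: t_def field_simps intro: order.trans[of _ 0])
    show ?thesis
    proof
      show "wave t = v" "wave' t = y"
        using t rising_phases_subset wave_base[of t] wave'_base[of t] sin \<theta>(3) a True
        by (auto simp: arch_def arch'_def stretch_nonneg_arg t_def)
    qed (rule t)
  next
    case False
    define t where "t = - \<theta> / b"
    have t: "t \<in> rising_phases" "t \<le> 0" using \<theta> a b
      by (auto simp: t_def field_simps intro: order.trans[of _ 0])
    show ?thesis
    proof
      show "wave t = v" "wave' t = y"
        using t rising_phases_subset wave_base[of t] wave'_base[of t] sin \<theta>(3) b False
        by (auto simp: arch_def arch'_def stretch_nonpos_arg t_def)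
    qed (rule t)
  qed
qed

text \<open>Dividing by \<open>N\<close>, the root of twice the energy at \<open>c\<close>, moves
  the data at \<open>c\<close> onto the phase curve of \<open>wave\<close>. The scaled translate
  with the matching phase has the same data, so uniqueness identifies it with
  \<open>u\<close>.\<close>

lemma rising_motion_is_wave:
  assumes u: "motion u u'" and "u' c \<ge> 0" and nz: "u \<noteq> (\<lambda>x. 0)"
  obtains N t where "N > 0" "t \<in> rising_phases" "u = (\<lambda>x. N * wave (x + (t - c)))"
proof -
  define N where "N = sqrt ((stretch (u c))\<^sup>2 + (u' c)\<^sup>2)"
  have zero: "motion (\<lambda>x. 0) (\<lambda>x. 0)" by (simp add: motion_def force_def)
  have "u c \<noteq> 0 \<or> u' c \<noteq> 0" using motion_unique[OF u zero, of c] nz by auto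
  then have "(stretch (u c))\<^sup>2 + (u' c)\<^sup>2 > 0"
    by (simp add: stretch_eq_0_iff sum_power2_gt_zero_iff)
  then have N: "N > 0" "N\<^sup>2 = (stretch (u c))\<^sup>2 + (u' c)\<^sup>2" by (auto simp: N_def)
  have "stretch (u c / N) = stretch (u c) / N"
    using N(1) by (auto simp: stretch_def max_def field_simps)
  then have "(stretch (u c / N))\<^sup>2 + (u' c / N)\<^sup>2 = 1"
    using N by (simp add: power_divide flip: add_divide_distrib N(2))
  moreover have "u' c / N \<ge> 0" using assms(2) N by simp
  ultimately obtain t where t: "t \<in> rising_phases" "wave t = u c / N" "wave' t = u' c / N"
    by (rule rising_phase_exists)
  have "motion (\<lambda>x. N * wave (x + (t - c))) (\<lambda>x. N * wave' (x + (t - c)))"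
    using motion_scale[OF motion_shift[OF motion_wave], of N] N(1) by simp
  then have "u = (\<lambda>x. N * wave (x + (t - c)))"
    using t N(1) by (intro motion_unique[OF u, of _ "\<lambda>x. N * wave' (x + (t - c))" c]) auto
  with N(1) t(1) show ?thesis by (rule that)
qed

section \<open>The boundary condition as an equation for the phase\<close>

lemma weighted_phase_points_inside:
  assumes \<alpha>: "\<And>i. i \<in> I \<Longrightarrow> \<alpha> i \<ge> 0" and "(\<Sum>i\<in>I. \<alpha> i) < 1"
  shows "(stretch (\<Sum>i\<in>I. \<alpha> i * wave (x i)))\<^sup>2 + (\<Sum>i\<in>I. \<alpha> i * wave' (x i))\<^sup>2 < 1"
proof -
  define P where "P = (\<Sum>i\<in>I. \<alpha> i * stretch (wave (x i)))"
  define Y where "Y = (\<Sum>i\<in>I. \<alpha> i * wave' (x i))"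
  \<comment> \<open>The complex modulus serves as Euclidean norm: by \<open>wave_energy\<close> the
    stretched phase points have modulus 1, so the triangle inequality bounds their weighted sum by
    the sum of the weights.\<close>
  have "Complex P Y = (\<Sum>i\<in>I. of_real (\<alpha> i) * Complex (stretch (wave (x i))) (wave' (x i)))"
    by (auto simp: P_def Y_def complex_eq_iff)
  also have "norm \<dots> \<le> (\<Sum>i\<in>I. \<alpha> i)"
  proof (rule sum_norm_le)
    fix i assume "i \<in> I"
    moreover have "norm (Complex (stretch (wave (x i))) (wave' (x i))) = 1"
      by (simp add: cmod_def wave_energy)
    ultimately show "norm (of_real (\<alpha> i) * Complex (stretch (wave (x i))) (wave' (x i))) \<le> \<alpha> i"
      unfolding norm_mult by (simp add: \<alpha>)
  qed
  finally have "(norm (Complex P Y))\<^sup>2 < 1"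
    using assms(2) by (simp add: power_less_one_iff abs_square_less_1)
  then have "P\<^sup>2 + Y\<^sup>2 < 1" by (simp add: cmod_power2)
  \<comment> \<open>Sublinearity of \<open>stretch\<close> allows the average to be taken before
    stretching.\<close>
  moreover have "(stretch (\<Sum>i\<in>I. \<alpha> i * wave (x i)))\<^sup>2 \<le> P\<^sup>2"
    unfolding P_def by (intro power_mono stretch_sum_le stretch_nonneg \<alpha>)
  ultimately show ?thesis by (simp add: Y_def)
qed

lemma rising_phase_unique:
  fixes \<alpha> d :: "'i \<Rightarrow> real"
  assumes \<alpha>: "\<And>i. i \<in> I \<Longrightarrow> \<alpha> i \<ge> 0" and sum: "(\<Sum>i\<in>I. \<alpha> i) < 1"
  shows "\<exists>t. t \<in> rising_phases \<and> wave t = (\<Sum>i\<in>I. \<alpha> i * wave (t + d i)) \<and> wave' t > 0 \<and>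
    (\<forall>r. r \<in> rising_phases \<longrightarrow> wave r = (\<Sum>i\<in>I. \<alpha> i * wave (r + d i)) \<longrightarrow> r = t)"
proof -
  define F where "F = (\<lambda>t. wave t - (\<Sum>i\<in>I. \<alpha> i * wave (t + d i)))"
  define F' where "F' = (\<lambda>t. wave' t - (\<Sum>i\<in>I. \<alpha> i * wave' (t + d i)))"
  have der: "(F has_real_derivative F' t) (at t)" for t
  proof -
    have "(wave has_real_derivative wave' t) (at t)"
      "((\<lambda>t. wave (t + d i)) has_real_derivative wave' (t + d i)) (at t)" for i
      using motion_wave motion_shift[OF motion_wave, of "d i"] by (simp_all add: motion_def)
    then show ?thesis unfolding F_def F'_def
      by (intro DERIV_diff DERIV_sum DERIV_cmult)
  qed
  have slope: "F' t > 0 \<and> wave' t > 0" if t: "t \<in> rising_phases" "F t = 0" for t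
  proof -
    \<comment> \<open>At a zero of \<open>F\<close> the weighted sum of positions equals
      \<open>wave t\<close>, so the position terms cancel and only the velocities are
      compared.\<close>
    have "(stretch (wave t))\<^sup>2 + (\<Sum>i\<in>I. \<alpha> i * wave' (t + d i))\<^sup>2 < (stretch (wave t))\<^sup>2 + (wave' t)\<^sup>2"
      using weighted_phase_points_inside[of I \<alpha> "\<lambda>i. t + d i"] \<alpha> sum t(2)
      unfolding wave_energy by (simp add: F_def)
    then have less: "(\<Sum>i\<in>I. \<alpha> i * wave' (t + d i))\<^sup>2 < (wave' t)\<^sup>2" by simp
    then have "(\<Sum>i\<in>I. \<alpha> i * wave' (t + d i)) < wave' t"
      using wave'_nonneg[OF t(1)] by (rule power2_less_imp_less)
    \<comment> \<open>A square strictly below \<open>(wave' t)\<^sup>2\<close> rules out slope zero,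
      which upgrades \<open>wave'_nonneg\<close> to strict positivity.\<close>
    moreover have "wave' t \<noteq> 0" using less by (smt (verit) zero_le_power2 zero_power2)
    ultimately show ?thesis using wave'_nonneg[OF t(1)] by (simp add: F'_def)
  qed
  \<comment> \<open>At this end \<open>wave\<close> attains its minimum, which is negative; weights
    of total less than 1 keep the weighted sum strictly above it. The other end is the same with the
    maximum.\<close>
  have left: "F (- pi / (2 * b)) < 0"
  proof -
    have "wave x \<ge> - 1 / b" for x using wave_ge[of x] b by (simp add: field_simps)
    then have "(\<Sum>i\<in>I. \<alpha> i * wave (- pi / (2 * b) + d i)) \<ge> (\<Sum>i\<in>I. \<alpha> i * (- 1 / b))"
      by (intro sum_mono mult_left_mono \<alpha>)
    moreover have "(\<Sum>i\<in>I. \<alpha> i * (- 1 / b)) = - (\<Sum>i\<in>I. \<alpha> i) / b"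
      by (simp add: sum_negf sum_divide_distrib)
    moreover have "- (\<Sum>i\<in>I. \<alpha> i) / b > - 1 / b" using sum b by (simp add: divide_strict_right_mono)
    ultimately show ?thesis unfolding F_def wave_rising_ends by linarith
  qed
  have right: "F (pi / (2 * a)) > 0"
  proof -
    have "wave x \<le> 1 / a" for x using wave_le[of x] a by (simp add: field_simps)
    then have "(\<Sum>i\<in>I. \<alpha> i * wave (pi / (2 * a) + d i)) \<le> (\<Sum>i\<in>I. \<alpha> i * (1 / a))"
      by (intro sum_mono mult_left_mono \<alpha>)
    also have "\<dots> = (\<Sum>i\<in>I. \<alpha> i) / a" by (simp add: sum_divide_distrib)
    also have "\<dots> < 1 / a" using sum a by (simp add: divide_strict_right_mono)
    finally show ?thesis unfolding F_def wave_rising_ends by linarith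
  qed
  have "- pi / (2 * b) \<le> pi / (2 * a)" using cell_nonempty a b by (simp add: field_simps)
  moreover have "continuous_on rising_phases F"
    by (rule DERIV_continuous_on) (rule has_field_derivative_at_within[OF der])
  ultimately obtain t where t: "t \<in> rising_phases" "F t = 0"
    using IVT'[of F "- pi / (2 * b)" 0 "pi / (2 * a)"] left right by force
  have "r = t" if "r \<in> rising_phases" "F r = 0" for r
    by (rule unique_zero_if_increasing_at_zeros[OF der _ that t]) (use slope in blast)
  moreover have "F x = 0 \<longleftrightarrow> wave x = (\<Sum>i\<in>I. \<alpha> i * wave (x + d i))" for x
    unfolding F_def by (rule right_minus_eq)
  ultimately show ?thesis using t slope[OF t] by blast
qed

section \<open>The two rays of solutions\<close>

lemma rising_ray:
  fixes \<alpha> \<eta> :: "'i \<Rightarrow> real"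
  assumes \<alpha>: "\<And>i. i \<in> I \<Longrightarrow> \<alpha> i \<ge> 0" and sum: "(\<Sum>i\<in>I. \<alpha> i) < 1"
  obtains \<psi> \<psi>' where "motion \<psi> \<psi>'" "\<psi> c = (\<Sum>i\<in>I. \<alpha> i * \<psi> (\<eta> i))" "\<psi>' c > 0"
    "\<And>u u'. motion u u' \<Longrightarrow> u c = (\<Sum>i\<in>I. \<alpha> i * u (\<eta> i)) \<Longrightarrow> u' c \<ge> 0 \<Longrightarrow>
       \<exists>C\<ge>0. u = (\<lambda>x. C * \<psi> x)"
proof -
  obtain t where t: "t \<in> rising_phases" "wave t = (\<Sum>i\<in>I. \<alpha> i * wave (t + (\<eta> i - c)))" "wave' t > 0"
    and uniq: "\<And>r. r \<in> rising_phases \<Longrightarrow> wave r = (\<Sum>i\<in>I. \<alpha> i * wave (r + (\<eta> i - c))) \<Longrightarrow> r = t"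
    using rising_phase_unique[OF \<alpha> sum, of "\<lambda>i. \<eta> i - c"] by blast
  show ?thesis
  proof
    show "motion (\<lambda>x. wave (x + (t - c))) (\<lambda>x. wave' (x + (t - c)))"
      by (rule motion_shift[OF motion_wave])
    show "wave (c + (t - c)) = (\<Sum>i\<in>I. \<alpha> i * wave (\<eta> i + (t - c)))"
      using t(2) by (simp add: algebra_simps)
    show "wave' (c + (t - c)) > 0" using t(3) by simp
  next
    fix u u' assume u: "motion u u'" "u c = (\<Sum>i\<in>I. \<alpha> i * u (\<eta> i))" "u' c \<ge> 0"
    show "\<exists>C\<ge>0. u = (\<lambda>x. C * wave (x + (t - c)))"
    proof (cases "u = (\<lambda>x. 0)")
      case True
      then show ?thesis by (intro exI[of _ 0]) simp
    next
      case False
      then obtain N r where r: "N > 0" "r \<in> rising_phases" and ueq: "u = (\<lambda>x. N * wave (x + (r - c)))"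
        using rising_motion_is_wave[OF u(1,3)] by metis
      \<comment> \<open>The boundary condition is homogeneous, so the amplitude \<open>N > 0\<close>
        cancels and the phase \<open>r\<close> solves the same equation as \<open>t\<close>.\<close>
      have "N * wave r = N * (\<Sum>i\<in>I. \<alpha> i * wave (r + (\<eta> i - c)))"
        using u(2) by (simp add: ueq sum_distrib_left algebra_simps)
      then have "r = t" using r by (intro uniq) auto
      with ueq r(1) show ?thesis by (intro exI[of _ N]) simp
    qed
  qed
qed

text \<open>Reflection at \<open>c\<close> turns a falling solution into a rising one with the
  points \<open>\<eta> i\<close> replaced by \<open>2 * c - \<eta> i\<close>, and
  \<open>rising_ray\<close> holds for arbitrary points.\<close>

lemma falling_ray:
  fixes \<alpha> \<eta> :: "'i \<Rightarrow> real"
  assumes \<alpha>: "\<And>i. i \<in> I \<Longrightarrow> \<alpha> i \<ge> 0" and sum: "(\<Sum>i\<in>I. \<alpha> i) < 1"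
  obtains \<psi> \<psi>' where "motion \<psi> \<psi>'" "\<psi> c = (\<Sum>i\<in>I. \<alpha> i * \<psi> (\<eta> i))" "\<psi>' c < 0"
    "\<And>u u'. motion u u' \<Longrightarrow> u c = (\<Sum>i\<in>I. \<alpha> i * u (\<eta> i)) \<Longrightarrow> u' c \<le> 0 \<Longrightarrow>
       \<exists>C\<ge>0. u = (\<lambda>x. C * \<psi> x)"
proof -
  obtain \<phi> \<phi>' where \<phi>: "motion \<phi> \<phi>'" "\<phi> c = (\<Sum>i\<in>I. \<alpha> i * \<phi> (2 * c - \<eta> i))" "\<phi>' c > 0"
    and all: "\<And>u u'. motion u u' \<Longrightarrow> u c = (\<Sum>i\<in>I. \<alpha> i * u (2 * c - \<eta> i)) \<Longrightarrow> u' c \<ge> 0 \<Longrightarrow>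
       \<exists>C\<ge>0. u = (\<lambda>x. C * \<phi> x)"
    by (rule rising_ray[OF \<alpha> sum, where \<eta> = "\<lambda>i. 2 * c - \<eta> i" and c = c]) (assumption | rule that)+
  show ?thesis
  proof
    show "motion (\<lambda>x. \<phi> (2 * c - x)) (\<lambda>x. - \<phi>' (2 * c - x))"
      by (rule motion_reflect[OF \<phi>(1)])
    show "\<phi> (2 * c - c) = (\<Sum>i\<in>I. \<alpha> i * \<phi> (2 * c - \<eta> i))" "- \<phi>' (2 * c - c) < 0"
      using \<phi> by simp_all
  next
    fix u u' assume u: "motion u u'" "u c = (\<Sum>i\<in>I. \<alpha> i * u (\<eta> i))" "u' c \<le> 0"
    obtain C where "C \<ge> 0" and C: "(\<lambda>x. u (2 * c - x)) = (\<lambda>x. C * \<phi> x)"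
      using all[OF motion_reflect[OF u(1), of "2 * c"]] u(2,3) by auto
    have "u x = C * \<phi> (2 * c - x)" for x using fun_cong[OF C, of "2 * c - x"] by simp
    with \<open>C \<ge> 0\<close> show "\<exists>C\<ge>0. u = (\<lambda>x. C * \<phi> (2 * c - x))" by blast
  qed
qed

section \<open>Passage between motions and twice continuously differentiable solutions\<close>

lemma motion_imp_deriv:
  assumes "motion u u'"
  shows "deriv u = u'" and "deriv (deriv u) = (\<lambda>x. - force (u x))"
proof -
  show 1: "deriv u = u'" using assms by (auto simp: motion_def fun_eq_iff intro: DERIV_imp_deriv)
  show "deriv (deriv u) = (\<lambda>x. - force (u x))"
    unfolding 1 using assms by (auto simp: motion_def fun_eq_iff intro: DERIV_imp_deriv)
qed

lemma motion_imp_C2: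
  assumes "motion u u'"
  shows "C2_real u"
proof -
  have "continuous_on UNIV u"
    using assms by (auto simp: motion_def intro!: DERIV_continuous_on)
  then have "continuous_on UNIV (\<lambda>x. - force (u x))"
    unfolding force_def by (intro continuous_intros)
  moreover have "u differentiable_on UNIV" "u' differentiable_on UNIV"
    using assms by (auto simp: motion_def differentiable_on_def real_differentiable_def)
  ultimately show ?thesis
    unfolding C2_real_def motion_imp_deriv(2)[OF assms] by (simp add: motion_imp_deriv(1)[OF assms])
qed

lemma C2_imp_motion:
  assumes "C2_real u" "\<And>x. - deriv (deriv u) x = force (u x)"
  shows "motion u (deriv u)"
proof -
  have "(u has_real_derivative deriv u x) (at x)"
    "(deriv u has_real_derivative deriv (deriv u) x) (at x)" for x
    using assms(1) by (auto simp: C2_real_def differentiable_on_def DERIV_deriv_iff_real_differentiable)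
  then show ?thesis using assms(2) unfolding motion_def by (metis add.inverse_inverse)
qed

end

theorem theorem4p1:
  fixes s \<gamma>p \<gamma>m \<eta>0 :: real and \<alpha> \<eta> :: "real ^ 'm"
  assumes "s > 0" and "\<gamma>p > 0" and "\<gamma>m > 0"
    and "\<forall>i. \<alpha> $ i \<ge> 0" and "(\<Sum>i\<in>UNIV. \<alpha> $ i) < 1"
  shows "\<exists>\<psi>p \<psi>m :: real \<Rightarrow> real.
           C2_real \<psi>p \<and> C2_real \<psi>m \<and>
           deriv \<psi>p \<eta>0 > 0 \<and> - deriv \<psi>m \<eta>0 > 0 \<and>
           {u. multipoint_solution s \<gamma>p \<gamma>m \<alpha> \<eta>0 \<eta> u} =
             {(\<lambda>x. C * \<psi>p x) | C. C \<ge> 0} \<union> {(\<lambda>x. C * \<psi>m x) | C. C \<ge> 0}"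
proof -
  interpret asymmetric_oscillator "s * \<gamma>p" "s * \<gamma>m"
    using assms by unfold_locales auto
  define BC where "BC = (\<lambda>u :: real \<Rightarrow> real. u \<eta>0 = (\<Sum>i\<in>UNIV. \<alpha> $ i * u (\<eta> $ i)))"
  have force: "s\<^sup>2 * (\<gamma>p\<^sup>2 * pos_part u x - \<gamma>m\<^sup>2 * neg_part u x) = force (u x)" for u x
    unfolding force_def by (simp add: pos_part_def neg_part_def algebra_simps power_mult_distrib)
  have solution: "multipoint_solution s \<gamma>p \<gamma>m \<alpha> \<eta>0 \<eta> u \<longleftrightarrow> motion u (deriv u) \<and> BC u" for u
    unfolding multipoint_solution_def force BC_def
    using C2_imp_motion[of u] motion_imp_C2[of u "deriv u"] motion_imp_deriv(2)[of u "deriv u"] by auto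
  \<comment> \<open>Both the equation and the boundary condition survive nonnegative factors, so
    each ray consists of solutions.\<close>
  have scaled: "multipoint_solution s \<gamma>p \<gamma>m \<alpha> \<eta>0 \<eta> (\<lambda>x. C * \<psi> x)"
    if "motion \<psi> \<psi>'" "BC \<psi>" "C \<ge> 0" for C \<psi> \<psi>'
    using motion_scale[OF that(1,3)] that(2) unfolding solution
    by (auto simp: motion_imp_deriv(1) BC_def sum_distrib_left mult.left_commute)
  obtain \<psi>p \<psi>p' where p: "motion \<psi>p \<psi>p'" "BC \<psi>p" "\<psi>p' \<eta>0 > 0"
    and allp: "\<And>u u'. motion u u' \<Longrightarrow> BC u \<Longrightarrow> u' \<eta>0 \<ge> 0 \<Longrightarrow> \<exists>C\<ge>0. u = (\<lambda>x. C * \<psi>p x)"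
    unfolding BC_def
    by (rule rising_ray[where I = UNIV and \<alpha> = "\<lambda>i. \<alpha> $ i" and \<eta> = "\<lambda>i. \<eta> $ i" and c = \<eta>0])
      (use assms(4,5) in \<open>auto intro: that\<close>)
  obtain \<psi>m \<psi>m' where m: "motion \<psi>m \<psi>m'" "BC \<psi>m" "\<psi>m' \<eta>0 < 0"
    and allm: "\<And>u u'. motion u u' \<Longrightarrow> BC u \<Longrightarrow> u' \<eta>0 \<le> 0 \<Longrightarrow> \<exists>C\<ge>0. u = (\<lambda>x. C * \<psi>m x)"
    unfolding BC_def
    by (rule falling_ray[where I = UNIV and \<alpha> = "\<lambda>i. \<alpha> $ i" and \<eta> = "\<lambda>i. \<eta> $ i" and c = \<eta>0])
      (use assms(4,5) in \<open>auto intro: that\<close>)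
  have "{u. multipoint_solution s \<gamma>p \<gamma>m \<alpha> \<eta>0 \<eta> u} =
    {(\<lambda>x. C * \<psi>p x) | C. C \<ge> 0} \<union> {(\<lambda>x. C * \<psi>m x) | C. C \<ge> 0}" (is "?S = ?P \<union> ?M")
  proof
    show "?S \<subseteq> ?P \<union> ?M"
    proof
      fix u assume "u \<in> ?S"
      then have u: "motion u (deriv u)" "BC u" by (auto simp: solution)
      show "u \<in> ?P \<union> ?M"
        \<comment> \<open>The sign of the slope at \<open>\<eta>0\<close> selects the ray; slope
          zero is put with the rising case.\<close>
        using allp[OF u] allm[OF u] by (cases "deriv u \<eta>0 \<ge> 0") auto
    qed
    show "?P \<union> ?M \<subseteq> ?S" using scaled[OF p(1,2)] scaled[OF m(1,2)] by auto
  qed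
  moreover have "deriv \<psi>p \<eta>0 > 0" "- deriv \<psi>m \<eta>0 > 0"
    using p(3) m(3) motion_imp_deriv(1)[OF p(1)] motion_imp_deriv(1)[OF m(1)] by auto
  ultimately show ?thesis using motion_imp_C2[OF p(1)] motion_imp_C2[OF m(1)] by blast
qed

end
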